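(* Let $\pi:(X,T)\to(Y,T)$ be a nontrivial factor map of minimal t.d.s. and $d\ge2$. If $(Y,T)$ is a $d$-step topological characteristic factor of $(X,T)$ (with respect to $\pi$), then there exists a dense $G_\delta$ subset $\Omega$ of $X$ such that for every $x\in\Omega$, $\pi^{-1}(\pi(x))$ is a $\Delta$-transitive set of order $d$ in $(X,T)$.
   Context: A t.d.s. $(X,T)$ is a compact metric space $X$ with a homeomorphism $T$; minimal: every orbit is dense; a factor map is a continuous equivariant surjection, nontrivial if it is not an isomorphism. $\mathbb{N}=\{1,2,\dots\}$. For $\pi:(X,T)\to(Y,T)$ a factor map, let $\tau_d=T\times T^2\times\cdots\times T^d$ on $X^d$. $(Y,T)$ is a $d$-step topological characteristic factor of $(X,T)$ if there is a dense $G_\delta$ set $X_0\subseteq X$ such that for every $x\in X_0$ the orbit closure $L_x=\overline{\{\tau_d^n(x,\dots,x):n\in\mathbb{Z}\}}\subseteq X^d$ is saturated for $\pi\times\cdots\times\pi$, i.e. if $(x_1,\dots,x_d)\in L_x$ and $\pi(x_i)=\pi(x_i')$ for all $i$ then $(x_1',\dots,x_d')\in L_x$. For subsets $U_0,\dots,U_d$ of $X$ let $N(U_0,\dots,U_d)=\{n\in\mathbb{N}:\bigcap_{i=0}^dT^{-in}U_i\neq\emptyset\}$. A closed set $A\subseteq X$ is a $\Delta$-transitive set of order $d$ if $N(U_0\cap A,U_1,\dots,U_d)\neq\emptyset$ for all non-empty open $U_0,\dots,U_d$ of $X$ intersecting $A$. *)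

theory Defs
  imports "HOL-Analysis.Analysis"
begin

text \<open>Spaces are types: a compact metric space is a type of class \<open>metric_space\<close> whose
  universe is compact. In particular, all spaces are nonempty.\<close>

definition tds :: "('a::metric_space \<Rightarrow> 'a) \<Rightarrow> bool" where
  "tds T \<longleftrightarrow> compact (UNIV :: 'a set) \<and> homeomorphism UNIV UNIV T (inv T)"

text \<open>The iterate of a bijection with an integer exponent.\<close>

definition iter :: "('a \<Rightarrow> 'a) \<Rightarrow> int \<Rightarrow> 'a \<Rightarrow> 'a" where
  "iter T n = (if n \<ge> 0 then T ^^ nat n else inv T ^^ nat (- n))"

definition minimal_tds :: "('a::metric_space \<Rightarrow> 'a) \<Rightarrow> bool" where
  "minimal_tds T \<longleftrightarrow> tds T \<and> (\<forall>x. closure (range (\<lambda>n. iter T n x)) = UNIV)"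

definition factor_map ::
    "('a::metric_space \<Rightarrow> 'a) \<Rightarrow> ('b::metric_space \<Rightarrow> 'b) \<Rightarrow> ('a \<Rightarrow> 'b) \<Rightarrow> bool" where
  "factor_map T S \<pi> \<longleftrightarrow>
     continuous_on UNIV \<pi> \<and> surj \<pi> \<and> (\<forall>x. \<pi> (T x) = S (\<pi> x))"

definition tds_isomorphism ::
    "('a::metric_space \<Rightarrow> 'a) \<Rightarrow> ('b::metric_space \<Rightarrow> 'b) \<Rightarrow> ('a \<Rightarrow> 'b) \<Rightarrow> bool" where
  "tds_isomorphism T S \<pi> \<longleftrightarrow> factor_map T S \<pi> \<and> homeomorphism UNIV UNIV \<pi> (inv \<pi>)"

definition nontrivial_factor_map ::
    "('a::metric_space \<Rightarrow> 'a) \<Rightarrow> ('b::metric_space \<Rightarrow> 'b) \<Rightarrow> ('a \<Rightarrow> 'b) \<Rightarrow> bool" where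
  "nontrivial_factor_map T S \<pi> \<longleftrightarrow> factor_map T S \<pi> \<and> \<not> tds_isomorphism T S \<pi>"

text \<open>The power \<open>X\<^sup>d\<close> is the topological product indexed by \<open>{1..d}\<close>; its points are the
  elements of \<open>{1..d} \<rightarrow>\<^sub>E UNIV\<close>, that is, functions on \<open>nat\<close> equal to \<open>undefined\<close> outside \<open>{1..d}\<close>.\<close>

abbreviation power_topology :: "nat \<Rightarrow> (nat \<Rightarrow> 'a::topological_space) topology" where
  "power_topology d \<equiv> product_topology (\<lambda>_. euclidean) {1..d}"

text \<open>The map \<open>T \<times> T\<^sup>2 \<times> \<dots> \<times> T\<^sup>d\<close>. It leaves the irrelevant coordinates outside \<open>{1..d}\<close>
  alone, so that it preserves the points of \<open>X\<^sup>d\<close> and is a bijection of the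
  whole function type whenever \<open>T\<close> is a bijection, as needed for \<open>iter\<close>.\<close>

definition tau :: "('a \<Rightarrow> 'a) \<Rightarrow> nat \<Rightarrow> (nat \<Rightarrow> 'a) \<Rightarrow> (nat \<Rightarrow> 'a)" where
  "tau T d x = (\<lambda>i. if i \<in> {1..d} then (T ^^ i) (x i) else x i)"

definition diagonal_orbit_closure ::
    "('a::metric_space \<Rightarrow> 'a) \<Rightarrow> nat \<Rightarrow> 'a \<Rightarrow> (nat \<Rightarrow> 'a) set" where
  "diagonal_orbit_closure T d x =
     power_topology d closure_of range (\<lambda>n. iter (tau T d) n (\<lambda>i\<in>{1..d}. x))"

definition saturated :: "('a \<Rightarrow> 'b) \<Rightarrow> nat \<Rightarrow> (nat \<Rightarrow> 'a) set \<Rightarrow> bool" where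
  "saturated \<pi> d L \<longleftrightarrow>
     (\<forall>z\<in>L. \<forall>z'\<in>{1..d} \<rightarrow>\<^sub>E UNIV. (\<forall>i\<in>{1..d}. \<pi> (z i) = \<pi> (z' i)) \<longrightarrow> z' \<in> L)"

definition topological_characteristic_factor ::
    "nat \<Rightarrow> ('a::metric_space \<Rightarrow> 'a) \<Rightarrow> ('b::metric_space \<Rightarrow> 'b) \<Rightarrow> ('a \<Rightarrow> 'b) \<Rightarrow> bool" where
  "topological_characteristic_factor d T S \<pi> \<longleftrightarrow>
     factor_map T S \<pi> \<and>
     (\<exists>X0. gdelta X0 \<and> closure X0 = UNIV \<and>
        (\<forall>x\<in>X0. saturated \<pi> d (diagonal_orbit_closure T d x)))"

definition return_times :: "('a \<Rightarrow> 'a) \<Rightarrow> nat \<Rightarrow> (nat \<Rightarrow> 'a set) \<Rightarrow> nat set" where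
  "return_times T d U = {n. n \<ge> 1 \<and> (\<Inter>i\<in>{0..d}. (T ^^ (i * n)) -` U i) \<noteq> {}}"

text \<open>In \<open>return_times T d (U(0 := U 0 \<inter> A))\<close> only the zeroth set is intersected with \<open>A\<close>.\<close>

definition Delta_transitive_set ::
    "('a::metric_space \<Rightarrow> 'a) \<Rightarrow> nat \<Rightarrow> 'a set \<Rightarrow> bool" where
  "Delta_transitive_set T d A \<longleftrightarrow>
     closed A \<and>
     (\<forall>U. (\<forall>i\<in>{0..d}. open (U i) \<and> U i \<inter> A \<noteq> {}) \<longrightarrow>
        return_times T d (U(0 := U 0 \<inter> A)) \<noteq> {})"

end

theory Submission
  imports Defs
begin

text \<open>
  For \<open>x\<close> in the residual set given by the hypothesis, saturation applied to the diagonal point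
  shows that \<open>L\<^sub>x\<close> contains \<open>A\<^sup>d\<close>, where \<open>A\<close> is the fibre through \<open>x\<close>; so \<open>(x, \<dots>, x)\<close> enters
  every box with sides meeting \<open>A\<close> at some integer time. For generic \<open>x\<close> that time can be taken
  positive, since \<open>(x, \<dots>, x)\<close> is recurrent under \<open>T \<times> \<dots> \<times> T\<^sup>d\<close> by the multiple recurrence theorem of
  Furstenberg and Weiss. It remains to find generic points in \<open>U\<^sub>0 \<inter> A\<close>: a factor map of minimal
  systems sends nonempty open sets to sets with nonempty interior, from which it follows that a
  residual subset of \<open>X\<close> is dense in almost every fibre.
\<close>

section \<open>Baire category and countable bases in compact metric spaces\<close>

text \<open>Baire's theorem in the compact Hausdorff subspace \<open>A\<close>. Density is only
  required relative to \<open>A\<close>, so that both the whole space and a single fibre can play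
  this role.\<close>

lemma compact_Baire:
  fixes A :: "'a::metric_space set" and V :: "nat \<Rightarrow> 'a set"
  assumes A: "compact A"
    and V: "\<And>n. open (V n)"
    and dense: "\<And>n U. open U \<Longrightarrow> U \<inter> A \<noteq> {} \<Longrightarrow> U \<inter> A \<inter> V n \<noteq> {}"
    and U: "open U" "U \<inter> A \<noteq> {}"
  shows "\<exists>x\<in>U \<inter> A. \<forall>n. x \<in> V n"
proof -
  let ?X = "top_of_set A"
  have "?X closure_of \<Inter>(range (\<lambda>n. A \<inter> V n)) = topspace ?X"
  proof (rule Baire_category)
    have "compact_space ?X"
      using A by (simp add: compact_space_subtopology)
    moreover have "Hausdorff_space ?X"
      by (simp add: Hausdorff_space_subtopology)
    ultimately show "completely_metrizable_space ?X \<or> locally_compact_space ?X \<and> regular_space ?X"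
      by (simp add: compact_imp_locally_compact_space compact_Hausdorff_imp_regular_space)
    show "countable (range (\<lambda>n. A \<inter> V n))" by simp
  next
    fix S assume "S \<in> range (\<lambda>n. A \<inter> V n)"
    then obtain n where S: "S = A \<inter> V n" by auto
    have "S \<inter> W \<noteq> {}" if W: "openin ?X W" "W \<noteq> {}" for W
    proof -
      obtain O' where O': "open O'" "W = A \<inter> O'"
        using W(1) unfolding openin_open by blast
      have "O' \<inter> A \<inter> V n \<noteq> {}" using dense O' W(2) by (metis inf_commute)
      then show ?thesis unfolding S O'(2) by blast
    qed
    then have "?X closure_of S = topspace ?X"
      using dense_intersects_open[of ?X S] by blast
    then show "openin ?X S \<and> ?X closure_of S = topspace ?X"
      using V[of n] unfolding S by (simp add: openin_open_Int)
  qed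
  moreover have "openin ?X (A \<inter> U)" using U(1) by (rule openin_open_Int)
  moreover have "A \<inter> U \<noteq> {}" using U(2) by auto
  ultimately have "\<Inter>(range (\<lambda>n. A \<inter> V n)) \<inter> (A \<inter> U) \<noteq> {}"
    unfolding dense_intersects_open by blast
  then show ?thesis by auto
qed

lemma closure_UNIV_iff:
  "closure S = UNIV \<longleftrightarrow> (\<forall>U. open U \<longrightarrow> U \<noteq> {} \<longrightarrow> U \<inter> S \<noteq> {})"
  by (metis UNIV_I closure_UNIV dense_intersects_open euclidean_closure_of inf_commute open_openin
      topspace_euclidean)

lemma interior_finite_Union_empty:
  assumes "finite \<F>" "\<And>A. A \<in> \<F> \<Longrightarrow> closed A \<and> interior A = {}"
  shows "interior (\<Union>\<F>) = {}"
  using assms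
proof (induction rule: finite_induct)
  case (insert A \<F>)
  then show ?case
    by (metis Union_insert closed_Union insertCI interior_closed_Un_empty_interior)
qed simp

lemma gdelta_countable_Inter:
  fixes \<W> :: "'a::topological_space set set"
  assumes "countable \<W>" "\<And>W. W \<in> \<W> \<Longrightarrow> open W"
  shows "gdelta (\<Inter>\<W>)"
proof (cases "\<W> = {}")
  case True
  then show ?thesis using gdelta.intros[of "\<lambda>_. UNIV :: 'a set"] by simp
next
  case False
  have "gdelta (\<Inter>(range (from_nat_into \<W>)))"
    by (rule gdelta.intros) (simp add: assms(2) False from_nat_into)
  then show ?thesis using assms(1) False by (simp add: range_from_nat_into)
qed

text \<open>Compactness gives total boundedness; the balls of radius \<open>1 / Suc k\<close> about
  finite nets form the base.\<close>

lemma compact_UNIV_countable_base: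
  assumes "compact (UNIV :: 'a::metric_space set)"
  obtains \<B> :: "'a::metric_space set set" where "countable \<B>" "\<And>B. B \<in> \<B> \<Longrightarrow> open B"
    "\<And>U x. open U \<Longrightarrow> x \<in> U \<Longrightarrow> \<exists>B\<in>\<B>. x \<in> B \<and> B \<subseteq> U"
proof -
  have "\<forall>k::nat. \<exists>C::'a set. finite C \<and> UNIV \<subseteq> (\<Union>x\<in>C. ball x (1 / Suc k))"
    using seq_compact_imp_totally_bounded[of "UNIV :: 'a set"] assms
    by (simp add: compact_eq_seq_compact_metric)
  then obtain C :: "nat \<Rightarrow> 'a set" where C: "\<And>k. finite (C k)"
    "\<And>k. UNIV \<subseteq> (\<Union>x\<in>C k. ball x (1 / Suc k))" by metis
  let ?B = "\<Union>k. (\<lambda>c. ball c (1 / Suc k)) ` C k"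
  show thesis
  proof (rule that[of ?B])
    show "countable ?B" using C(1) by (simp add: countable_finite)
    show "open B" if "B \<in> ?B" for B using that by auto
    show "\<exists>B\<in>?B. x \<in> B \<and> B \<subseteq> U" if U: "open U" "x \<in> U" for U x
    proof -
      obtain e where e: "e > 0" "ball x e \<subseteq> U"
        using openE[OF U] by blast
      obtain k :: nat where k: "1 / Suc k < e / 2"
        using e(1) nat_approx_posE[of "e/2"] by auto
      obtain c where c: "c \<in> C k" "x \<in> ball c (1 / Suc k)" using C(2)[of k] by blast
      have "ball c (1 / Suc k) \<subseteq> ball x e"
      proof
        fix y assume "y \<in> ball c (1 / Suc k)"
        then have "dist c y < e / 2" "dist c x < e / 2" using c(2) k by auto
        then show "y \<in> ball x e"
          using dist_triangle3[of x y c] by simp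
      qed
      then show ?thesis using c e(2) by blast
    qed
  qed
qed

section \<open>Integer iterates of a homeomorphism\<close>

lemma funpow_left_commute: "(f ^^ m) ((f ^^ n) x) = (f ^^ n) ((f ^^ m) x)"
proof -
  have "(f ^^ (m + n)) x = (f ^^ (n + m)) x" by (simp only: add.commute)
  then show ?thesis by (simp only: funpow_add comp_apply)
qed

context
  fixes T :: "'a::metric_space \<Rightarrow> 'a"
  assumes T: "tds T"
begin

lemma tds_inv_left: "inv T (T x) = x" and tds_inv_right: "T (inv T x) = x"
  and tds_continuous: "continuous_on UNIV T" and tds_continuous_inv: "continuous_on UNIV (inv T)"
  using T unfolding tds_def homeomorphism_def by auto

lemma continuous_on_funpow: "continuous_on UNIV (T ^^ n)"
  and continuous_on_funpow_inv: "continuous_on UNIV (inv T ^^ n)"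
proof -
  have *: "continuous_on UNIV (f ^^ n)" if "continuous_on UNIV f" for f :: "'a \<Rightarrow> 'a"
  proof (induction n)
    case (Suc n)
    show ?case unfolding funpow.simps(2)
      by (rule continuous_on_compose[OF Suc]) (rule continuous_on_subset[OF that subset_UNIV])
  qed (simp add: id_def)
  show "continuous_on UNIV (T ^^ n)" "continuous_on UNIV (inv T ^^ n)"
    by (rule *[OF tds_continuous], rule *[OF tds_continuous_inv])
qed

lemma funpow_inv_left: "(inv T ^^ n) ((T ^^ n) x) = x"
proof (induction n)
  case (Suc n)
  then show ?case
    by (simp only: funpow_Suc_right[of n "inv T"] funpow.simps(2)[of n T] comp_apply tds_inv_left)
qed simp

lemma funpow_inv_right: "(T ^^ n) ((inv T ^^ n) x) = x"
proof (induction n)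
  case (Suc n)
  then show ?case
    by (simp only: funpow_Suc_right[of n T] funpow.simps(2)[of n "inv T"] comp_apply tds_inv_right)
qed simp

lemma continuous_on_iter: "continuous_on UNIV (iter T g)"
  unfolding iter_def by (simp add: continuous_on_funpow continuous_on_funpow_inv)

lemma iter_minus_right: "iter T g (iter T (- g) x) = x"
  unfolding iter_def by (auto simp: funpow_inv_left funpow_inv_right)

lemma iter_minus_left: "iter T (- g) (iter T g x) = x"
  using iter_minus_right[of "- g" x] by simp

lemma funpow_inv_commute: "(inv T ^^ m) ((T ^^ n) x) = (T ^^ n) ((inv T ^^ m) x)"
proof -
  have "(T ^^ m) ((T ^^ n) ((inv T ^^ m) x)) = (T ^^ n) x"
    by (subst funpow_left_commute[of m]) (simp only: funpow_inv_right)
  then have "(inv T ^^ m) ((T ^^ m) ((T ^^ n) ((inv T ^^ m) x))) = (inv T ^^ m) ((T ^^ n) x)"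
    by (rule arg_cong)
  then show ?thesis by (simp only: funpow_inv_left)
qed

lemma iter_funpow_commute: "iter T g ((T ^^ n) x) = (T ^^ n) (iter T g x)"
proof (cases "g \<ge> 0")
  case True
  then show ?thesis by (simp add: iter_def funpow_left_commute[of "nat g"])
qed (simp add: iter_def funpow_inv_commute)

end

section \<open>Minimality and multiple recurrence\<close>

text \<open>Every orbit is dense and so meets \<open>U\<close>; hence the preimages of
  \<open>U\<close> under the iterates cover the space, and compactness leaves finitely many.\<close>

lemma minimal_finite_cover:
  fixes T :: "'a::metric_space \<Rightarrow> 'a"
  assumes "minimal_tds T" "open U" "U \<noteq> {}"
  obtains F where "finite F" "\<And>x. \<exists>g\<in>F. iter T g x \<in> U"
proof -
  have T: "tds T" using assms(1) by (simp add: minimal_tds_def)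
  have "open (iter T g -` U)" for g
    using continuous_on_iter[OF T] assms(2) by (simp add: open_vimage)
  moreover have "UNIV \<subseteq> (\<Union>g. iter T g -` U)"
  proof
    fix x
    have "closure (range (\<lambda>n. iter T n x)) = UNIV"
      using assms(1) by (simp add: minimal_tds_def)
    then have "U \<inter> range (\<lambda>n. iter T n x) \<noteq> {}"
      using assms(2,3) unfolding closure_UNIV_iff by blast
    then show "x \<in> (\<Union>g. iter T g -` U)" by auto
  qed
  ultimately obtain F where "finite F" "UNIV \<subseteq> (\<Union>g\<in>F. iter T g -` U)"
    using compactE_image[of UNIV UNIV "\<lambda>g. iter T g -` U"] T unfolding tds_def
    by (metis UNIV_I)
  then show thesis by (intro that[of F]) auto
qed

text \<open>
  Induction on \<open>d\<close>. Recurrence of order \<open>d\<close> yields open sets \<open>V\<^sub>k\<close> and times \<open>m\<^sub>k\<close> such that \<open>T\<^sup>j\<close>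
  iterated \<open>m\<^sub>k\<close> times maps \<open>V\<^sub>k\<close> into the preceding set for all \<open>1 \<le> j \<le> d + 1\<close>, each \<open>V\<^sub>k\<close> lying in
  one of finitely many translates of \<open>U\<close>. Two of the \<open>V\<^sub>k\<close> lie in the same translate.
\<close>

theorem topological_multiple_recurrence:
  fixes T :: "'a::metric_space \<Rightarrow> 'a"
  assumes "minimal_tds T" "open U" "U \<noteq> {}"
  shows "\<exists>x n. n \<ge> 1 \<and> (\<forall>j\<le>d. (T ^^ (j * n)) x \<in> U)"
  using assms(2,3)
proof (induction d arbitrary: U)
  case 0
  then show ?case by (auto intro: exI[of _ 1])
next
  case (Suc d)
  have T: "tds T" using assms(1) by (simp add: minimal_tds_def)
  obtain F where F: "finite F" "\<And>x. \<exists>g\<in>F. iter T g x \<in> U"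
    using minimal_finite_cover[OF assms(1) Suc.prems] by blast
  \<comment> \<open>A state consists of an open set, the time leading from it to its predecessor,
    and an index \<open>g\<close> with \<open>iter T g\<close> mapping the set into
    \<open>U\<close>.\<close>
  let ?P = "\<lambda>(k::nat) (V, n::nat, g). open V \<and> V \<noteq> {} \<and> g \<in> F \<and> (\<forall>x\<in>V. iter T g x \<in> U)"
  let ?Q = "\<lambda>(k::nat) (V, n::nat, g::int) (V', n', g'::int). n' \<ge> 1 \<and>
    (\<forall>x\<in>V'. \<forall>j\<in>{1..Suc d}. (T ^^ (j * n')) x \<in> V)"
  have op: "open ((T ^^ m) -` V)" "open (iter T g -` V)" if "open V" for V m g
    using that by (simp_all add: open_vimage continuous_on_funpow[OF T] continuous_on_iter[OF T])
  have pick: "\<exists>g\<in>F. open (V \<inter> iter T g -` U) \<and> V \<inter> iter T g -` U \<noteq> {}"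
    if "open V" "V \<noteq> {}" for V
    using that F(2) op(2)[OF Suc.prems(1)] by (metis IntI empty_iff ex_in_conv open_Int vimageI)
  have "\<exists>f. \<forall>k. ?P k (f k) \<and> ?Q k (f k) (f (Suc k))"
  proof (rule dependent_nat_choice)
    show "\<exists>s. ?P 0 s"
      using pick[of UNIV] by fastforce
  next
    fix s and k :: nat
    assume P: "?P k s"
    obtain V n g where s: "s = (V, n, g)" by (cases s)
    have V: "open V" "V \<noteq> {}" using P s by auto
    obtain x m where m: "m \<ge> 1" "\<And>j. j \<le> d \<Longrightarrow> (T ^^ (j * m)) x \<in> V"
      using Suc.IH[OF V] by blast
    let ?W = "\<Inter>j\<in>{1..Suc d}. (T ^^ (j * m)) -` V"
    have "open ?W" using op(1)[OF V(1)] by (intro open_INT) auto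
    \<comment> \<open>Moving the recurrent point back by \<open>m\<close> shifts the multiples
      \<open>0, ..., d\<close> of the return time to \<open>1, ..., d + 1\<close>.\<close>
    moreover have "(inv T ^^ m) x \<in> ?W"
    proof (intro INT_I vimageI2)
      fix j assume j: "j \<in> {1..Suc d}"
      have "j * m = (j - 1) * m + m" using j by (cases j) auto
      then have "(T ^^ (j * m)) ((inv T ^^ m) x) = (T ^^ ((j - 1) * m)) x"
        by (simp add: funpow_add funpow_inv_right[OF T])
      then show "(T ^^ (j * m)) ((inv T ^^ m) x) \<in> V" using m(2)[of "j - 1"] j by auto
    qed
    ultimately obtain g' where "g' \<in> F" "open (?W \<inter> iter T g' -` U)" "?W \<inter> iter T g' -` U \<noteq> {}"
      using pick[of ?W] by (metis empty_iff)
    then show "\<exists>s'. ?P (Suc k) s' \<and> ?Q k s s'"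
      using m(1) unfolding s by (intro exI[of _ "(?W \<inter> iter T g' -` U, m, g')"]) auto
  qed
  then obtain f where all: "\<forall>k. ?P k (f k) \<and> ?Q k (f k) (f (Suc k))" ..
  have f: "?P k (f k)" "?Q k (f k) (f (Suc k))" for k
    by (rule all[THEN spec, THEN conjunct1], rule all[THEN spec, THEN conjunct2])
  define V where "V k = fst (f k)" for k
  define m where "m k = fst (snd (f k))" for k
  define g where "g k = snd (snd (f k))" for k
  have V: "V k \<noteq> {}" and g: "g k \<in> F" "\<And>x. x \<in> V k \<Longrightarrow> iter T (g k) x \<in> U" for k
    using f(1)[of k] by (auto simp: V_def g_def split_beta)
  have m: "m (Suc k) \<ge> 1"
    and step: "\<And>x j. x \<in> V (Suc k) \<Longrightarrow> j \<in> {1..Suc d} \<Longrightarrow> (T ^^ (j * m (Suc k))) x \<in> V k" for k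
    using f(2)[of k] by (auto simp: V_def m_def split_beta)
  \<comment> \<open>Times of successive steps add up, simultaneously for all multiples
    \<open>j\<close>.\<close>
  have chain: "\<exists>n\<ge>1. \<forall>x\<in>V (k + Suc l). \<forall>j\<in>{1..Suc d}. (T ^^ (j * n)) x \<in> V k" for k l
  proof (induction l)
    case 0
    then show ?case using m[of k] step[of _ k] by auto
  next
    case (Suc l)
    then obtain n where n: "n \<ge> 1"
      "\<And>x j. x \<in> V (k + Suc l) \<Longrightarrow> j \<in> {1..Suc d} \<Longrightarrow> (T ^^ (j * n)) x \<in> V k" by blast
    show ?case
    proof (intro exI[of _ "n + m (Suc (k + Suc l))"] conjI ballI)
      fix x j assume "x \<in> V (k + Suc (Suc l))" and j: "j \<in> {1..Suc d}"
      then have "(T ^^ (j * m (Suc (k + Suc l)))) x \<in> V (k + Suc l)" using step by simp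
      from n(2)[OF this j] show "(T ^^ (j * (n + m (Suc (k + Suc l))))) x \<in> V k"
        by (simp add: distrib_left funpow_add)
    qed (use n in auto)
  qed
  have "\<not> inj g" using F(1) g(1) by (metis finite_subset image_subsetI infinite_UNIV_nat range_inj_infinite)
  then obtain k k' where "g k = g k'" "k < k'"
    unfolding inj_def by (metis linorder_neqE_nat)
  then obtain l where l: "g (k + Suc l) = g k" using less_iff_Suc_add[of k k'] by auto
  obtain n where n: "n \<ge> 1"
    "\<And>x j. x \<in> V (k + Suc l) \<Longrightarrow> j \<in> {1..Suc d} \<Longrightarrow> (T ^^ (j * n)) x \<in> V k"
    using chain by blast
  obtain x where x: "x \<in> V (k + Suc l)" using V by blast
  \<comment> \<open>Both \<open>V k\<close> and \<open>V (k + Suc l)\<close> are carried into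
    \<open>U\<close> by the same \<open>iter T (g k)\<close>: the latter contains \<open>x\<close>,
    which settles \<open>j = 0\<close>, and the former contains the iterates of \<open>x\<close> for
    \<open>j\<close> at least 1.\<close>
  have "(T ^^ (j * n)) (iter T (g k) x) \<in> U" if "j \<le> Suc d" for j
  proof (cases "j = 0")
    case True
    then show ?thesis using g(2)[OF x] l by simp
  next
    case False
    then have "iter T (g k) ((T ^^ (j * n)) x) \<in> U"
      using that n(2)[OF x] g(2) by auto
    then show ?thesis by (simp add: iter_funpow_commute[OF T])
  qed
  then show ?case using n(1) by blast
qed

section \<open>Factor maps of minimal systems\<close>

lemma factor_map_iter:
  assumes "factor_map T S \<pi>" "tds T" "tds S"
  shows "\<pi> (iter T g x) = iter S g (\<pi> x)"
proof -
  have eq: "\<pi> (T x) = S (\<pi> x)" for x using assms(1) by (simp add: factor_map_def)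
  have pos: "\<pi> ((T ^^ n) x) = (S ^^ n) (\<pi> x)" for n x
    by (induction n) (simp_all add: eq)
  have neg: "\<pi> ((inv T ^^ n) x) = (inv S ^^ n) (\<pi> x)" for n
    using arg_cong[OF pos[of n "(inv T ^^ n) x"], of "inv S ^^ n"]
    by (simp only: funpow_inv_left[OF assms(3)] funpow_inv_right[OF assms(2)])
  show ?thesis by (simp add: iter_def pos neg)
qed

text \<open>Finitely many translates of the image of a small closed ball cover the factor. They are
  closed, so one of them has interior, and translating back puts interior into the image
  itself.\<close>

lemma minimal_factor_map_semiopen:
  fixes T :: "'a::metric_space \<Rightarrow> 'a" and S :: "'b::metric_space \<Rightarrow> 'b"
  assumes T: "minimal_tds T" and S: "tds S" and \<pi>: "factor_map T S \<pi>"
    and U: "open U" "U \<noteq> {}"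
  shows "interior (\<pi> ` U) \<noteq> {}"
proof -
  have T': "tds T" using T by (simp add: minimal_tds_def)
  \<comment> \<open>The open ball serves for minimality, the closed one for a compact image.\<close>
  obtain a r where r: "r > 0" "cball a r \<subseteq> U"
    using U open_contains_cball by (metis ex_in_conv)
  let ?K = "cball a r"
  obtain F where F: "finite F" "\<And>x. \<exists>g\<in>F. iter T g x \<in> ball a r"
    using minimal_finite_cover[OF T, of "ball a r"] r(1) by auto
  have "compact ?K"
    using T' unfolding tds_def by (metis closed_cball compact_Int_closed inf_top_left)
  then have "compact (\<pi> ` ?K)"
    using \<pi> by (meson compact_continuous_image continuous_on_subset factor_map_def subset_UNIV)
  then have cl: "closed (iter S g -` (\<pi> ` ?K))" for g
    using continuous_on_iter[OF S] by (simp add: closed_vimage compact_imp_closed)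
  have "(\<Union>g\<in>F. iter S g -` (\<pi> ` ?K)) = UNIV"
  proof -
    have "\<exists>g\<in>F. iter S g y \<in> \<pi> ` ?K" for y
    proof -
      obtain x where x: "y = \<pi> x" using \<pi> by (auto simp: factor_map_def)
      obtain g where "g \<in> F" "iter T g x \<in> ball a r" using F(2) by blast
      then show ?thesis unfolding x factor_map_iter[OF \<pi> T' S, symmetric]
        by (intro bexI[of _ g] imageI) auto
    qed
    then show ?thesis by auto
  qed
  then have "interior (\<Union>g\<in>F. iter S g -` (\<pi> ` ?K)) \<noteq> {}" by simp
  then obtain g where g: "interior (iter S g -` (\<pi> ` ?K)) \<noteq> {}"
    using interior_finite_Union_empty[of "(\<lambda>g. iter S g -` (\<pi> ` ?K)) ` F"] F(1) cl by blast
  let ?W = "iter S (- g) -` interior (iter S g -` (\<pi> ` ?K))"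
  have "open ?W" using continuous_on_iter[OF S] by (simp add: open_vimage)
  moreover have "?W \<subseteq> \<pi> ` U"
  proof
    fix y assume "y \<in> ?W"
    then have "iter S g (iter S (- g) y) \<in> \<pi> ` ?K" using interior_subset by blast
    then show "y \<in> \<pi> ` U" using r(2) by (auto simp: iter_minus_right[OF S])
  qed
  ultimately have sub: "?W \<subseteq> interior (\<pi> ` U)" by (simp add: interior_maximal)
  obtain z where "z \<in> interior (iter S g -` (\<pi> ` ?K))" using g by blast
  then have "iter S g z \<in> ?W" by (simp add: iter_minus_left[OF S])
  then show ?thesis using sub by blast
qed


text \<open>
  For \<open>B\<close> in a countable base, the closed set \<open>E B n\<close> contains every point whose fibre meets \<open>B\<close> but
  not \<open>B \<inter> V n\<close>. Semi-openness makes it nowhere dense.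
\<close>

lemma factor_map_generic_fibre_dense:
  fixes T :: "'a::metric_space \<Rightarrow> 'a" and S :: "'b::metric_space \<Rightarrow> 'b"
    and V :: "nat \<Rightarrow> 'a set"
  assumes T: "minimal_tds T" and S: "tds S" and \<pi>: "factor_map T S \<pi>"
    and V: "\<And>n. open (V n)" "\<And>n. closure (V n) = UNIV"
  shows "\<exists>\<Omega>. gdelta \<Omega> \<and> closure \<Omega> = UNIV \<and>
    (\<forall>x\<in>\<Omega>. \<forall>U. open U \<longrightarrow> U \<inter> \<pi> -` {\<pi> x} \<noteq> {} \<longrightarrow>
       (\<exists>z\<in>U \<inter> \<pi> -` {\<pi> x}. \<forall>n. z \<in> V n))"
proof -
  have cX: "compact (UNIV :: 'a set)" using T by (simp add: minimal_tds_def tds_def)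
  have cont: "continuous_on UNIV \<pi>" using \<pi> by (simp add: factor_map_def)
  obtain \<B> :: "'a set set" where \<B>: "countable \<B>" "\<And>B. B \<in> \<B> \<Longrightarrow> open B"
    "\<And>U x. open U \<Longrightarrow> x \<in> U \<Longrightarrow> \<exists>B\<in>\<B>. x \<in> B \<and> B \<subseteq> U"
    using compact_UNIV_countable_base[OF cX] by blast
  \<comment> \<open>Taking \<open>closure B\<close> makes its image compact and \<open>E B n\<close>
    closed, so \<open>W B n\<close> is open.\<close>
  define E where "E B n = \<pi> ` closure B - interior (\<pi> ` (B \<inter> V n))" for B n
  define W where "W B n = \<pi> -` (- E B n)" for B n
  have oW: "open (W B n)" for B n
  proof -
    have "compact (closure B)" using cX by (metis closed_closure compact_Int_closed inf_top_left)
    then have "closed (\<pi> ` closure B)"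
      using cont by (meson compact_continuous_image compact_imp_closed continuous_on_subset subset_UNIV)
    then have "open (- E B n)" unfolding E_def by (intro open_Compl closed_Diff) auto
    then show ?thesis unfolding W_def using cont by (simp add: open_vimage)
  qed
  have dW: "U \<inter> W B n \<noteq> {}" if U: "open U" "U \<noteq> {}" and B: "open B" for U B n
  proof
    assume "U \<inter> W B n = {}"
    then have sub: "\<pi> ` U \<subseteq> E B n" unfolding W_def by auto
    \<comment> \<open>Semi-openness is used twice: for \<open>U\<close>, giving \<open>G\<close>
      inside \<open>E B n\<close>, and for the part of \<open>B \<inter> V n\<close> lying over
      \<open>G\<close>, whose image then has interior points in \<open>G\<close> that
      \<open>E B n\<close> excludes.\<close>
    define G where "G = interior (\<pi> ` U)"
    have G: "G \<noteq> {}" "open G" "G \<subseteq> E B n"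
      using minimal_factor_map_semiopen[OF T S \<pi> U] subset_trans[OF interior_subset sub]
      unfolding G_def by auto
    have oG: "open (\<pi> -` G)" using cont G(2) by (simp add: open_vimage)
    have "\<pi> -` G \<inter> closure B \<noteq> {}" using G unfolding E_def by blast
    then have "\<pi> -` G \<inter> B \<noteq> {}" using open_Int_closure_eq_empty[OF oG] by blast
    then have ne: "\<pi> -` G \<inter> B \<inter> V n \<noteq> {}"
      using V(2)[of n] open_Int[OF oG B] unfolding closure_UNIV_iff by metis
    have "interior (\<pi> ` (\<pi> -` G \<inter> B \<inter> V n)) \<noteq> {}"
      by (intro minimal_factor_map_semiopen[OF T S \<pi> _ ne] open_Int oG B V(1))
    moreover have "interior (\<pi> ` (\<pi> -` G \<inter> B \<inter> V n)) \<subseteq> G"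
      by (rule subset_trans[OF interior_subset]) auto
    moreover have "interior (\<pi> ` (\<pi> -` G \<inter> B \<inter> V n)) \<subseteq> interior (\<pi> ` (B \<inter> V n))"
      by (intro interior_mono) auto
    moreover have "G \<inter> interior (\<pi> ` (B \<inter> V n)) = {}" using G(3) unfolding E_def by blast
    ultimately show False by blast
  qed
  define \<W> where "\<W> = (\<lambda>(B, n). W B n) ` (\<B> \<times> UNIV)"
  have c\<W>: "countable \<W>" unfolding \<W>_def using \<B>(1) by auto
  show ?thesis
  proof (intro exI[of _ "\<Inter>\<W>"] conjI ballI allI impI)
    show "gdelta (\<Inter>\<W>)"
      by (rule gdelta_countable_Inter[OF c\<W>]) (auto simp: \<W>_def oW)
    show "closure (\<Inter>\<W>) = UNIV"
      unfolding closure_UNIV_iff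
    proof (intro allI impI)
      fix U :: "'a set" assume U: "open U" "U \<noteq> {}"
      have "\<B> \<noteq> {}" using \<B>(3)[of UNIV undefined] by auto
      then have ne: "\<W> \<noteq> {}" unfolding \<W>_def by auto
      then have mem: "from_nat_into \<W> n \<in> \<W>" for n by (rule from_nat_into)
      have "\<exists>x\<in>U \<inter> UNIV. \<forall>n. x \<in> from_nat_into \<W> n"
      proof (rule compact_Baire[OF cX])
        show "open (from_nat_into \<W> n)" for n
          using mem[of n] oW unfolding \<W>_def by auto
        show "U \<inter> UNIV \<inter> from_nat_into \<W> n \<noteq> {}" if "open U" "U \<inter> UNIV \<noteq> {}" for n U
          using mem[of n] dW[OF that(1)] that(2) \<B>(2) unfolding \<W>_def by auto
      qed (use U in auto)
      moreover have "\<Inter>\<W> = (\<Inter>n. from_nat_into \<W> n)"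
        by (simp add: range_from_nat_into ne c\<W>)
      ultimately show "U \<inter> \<Inter>\<W> \<noteq> {}"
        by auto
    qed
  next
    fix x U assume x: "x \<in> \<Inter>\<W>" and U: "open U" "U \<inter> \<pi> -` {\<pi> x} \<noteq> {}"
    let ?A = "\<pi> -` {\<pi> x}"
    \<comment> \<open>The second use of Baire is inside the fibre: as \<open>x\<close> lies in every
      \<open>W B n\<close>, each \<open>V n\<close> is dense in the fibre.\<close>
    have "compact ?A"
      using compact_Int_closed[OF cX closed_vimage[OF closed_singleton cont]] by simp
    then show "\<exists>z\<in>U \<inter> ?A. \<forall>n. z \<in> V n"
    proof (rule compact_Baire)
      fix n and U :: "'a set" assume U: "open U" "U \<inter> ?A \<noteq> {}"
      obtain a where "a \<in> U" and a: "a \<in> ?A" using U(2) by blast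
      obtain B where B: "B \<in> \<B>" "a \<in> B" "B \<subseteq> U" using \<B>(3)[OF U(1) \<open>a \<in> U\<close>] by blast
      have "x \<in> W B n" using x B(1) unfolding \<W>_def by auto
      moreover have "\<pi> x \<in> \<pi> ` closure B"
        using a subsetD[OF closure_subset B(2)] by (intro image_eqI[of _ _ a]) auto
      ultimately have "\<pi> x \<in> interior (\<pi> ` (B \<inter> V n))" unfolding W_def E_def by blast
      then have "\<pi> x \<in> \<pi> ` (B \<inter> V n)" by (rule subsetD[OF interior_subset])
      then show "U \<inter> ?A \<inter> V n \<noteq> {}" using B(3) by auto
    qed (use V U in auto)
  qed
qed

section \<open>Returns of the diagonal point to itself\<close>

text \<open>One index \<open>k\<close> bounds the time from below and the error from above, so a
  point lying in these sets for all \<open>k\<close> has a diagonal point returning arbitrarily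
  closely at arbitrarily late times.\<close>

definition near_returns :: "('a::metric_space \<Rightarrow> 'a) \<Rightarrow> nat \<Rightarrow> nat \<Rightarrow> 'a set" where
  "near_returns T d k = {x. \<exists>n\<ge>k. \<forall>j\<le>d. dist ((T ^^ (j * n)) x) x < 1 / Suc k}"

lemma open_near_returns:
  assumes "tds T"
  shows "open (near_returns T d k)"
proof -
  have "near_returns T d k = (\<Union>n\<in>{k..}. \<Inter>j\<in>{..d}. {x. dist ((T ^^ (j * n)) x) x < 1 / Suc k})"
    unfolding near_returns_def by auto
  moreover have "open {x. dist ((T ^^ m) x) x < 1 / Suc k}" for m
    by (intro open_Collect_less continuous_intros continuous_on_funpow[OF assms])
  ultimately show ?thesis by (auto intro!: open_UN open_INT)
qed

text \<open>Multiple recurrence inside a ball of half the allowed error: the point and its iterates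
  share that ball.\<close>

lemma dense_near_returns:
  assumes "minimal_tds T"
  shows "closure (near_returns T d k) = UNIV"
  unfolding closure_UNIV_iff
proof (intro allI impI)
  fix U :: "'a set" assume "open U" "U \<noteq> {}"
  then obtain a where a: "a \<in> U" by auto
  let ?B = "U \<inter> ball a (1 / (2 * Suc k))"
  have "open ?B" "?B \<noteq> {}" using \<open>open U\<close> a by auto
  \<comment> \<open>Recurrence of order \<open>d * Suc k\<close> with time \<open>n\<close> contains recurrence of order \<open>d\<close> with the large time \<open>Suc k * n\<close>.\<close>
  then obtain x n where n: "n \<ge> 1" and x: "\<And>j. j \<le> d * Suc k \<Longrightarrow> (T ^^ (j * n)) x \<in> ?B"
    using topological_multiple_recurrence[OF assms, of ?B "d * Suc k"] by blast
  have x0: "x \<in> ?B" using x[of 0] by simp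
  have "dist ((T ^^ (j * (Suc k * n))) x) x < 1 / Suc k" if "j \<le> d" for j
  proof -
    have "j * Suc k \<le> d * Suc k" using that by (rule mult_le_mono1)
    from x[OF this] have "(T ^^ (j * (Suc k * n))) x \<in> ball a (1 / (2 * Suc k))"
      unfolding mult.assoc by blast
    then have "dist ((T ^^ (j * (Suc k * n))) x) x < 1 / (2 * Suc k) + 1 / (2 * Suc k)"
      using x0 dist_triangle3[of "(T ^^ (j * (Suc k * n))) x" x a] by auto
    then show ?thesis by (simp add: field_simps)
  qed
  moreover have "Suc k * n \<ge> k" using n by (cases n) auto
  ultimately have "x \<in> near_returns T d k" unfolding near_returns_def by blast
  then show "U \<inter> near_returns T d k \<noteq> {}" using x0 by auto
qed

section \<open>Orbits of \<open>tau\<close> and saturation\<close>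

lemma funpow_tau:
  assumes "i \<in> {1..d}"
  shows "(tau T d ^^ n) p i = (T ^^ (i * n)) (p i)"
  using assms by (induction n) (simp_all add: tau_def funpow_add)

lemma inv_tau:
  assumes "tds T"
  shows "inv (tau T d) = tau (inv T) d"
  by (rule inv_unique_comp)
    (auto simp: tau_def fun_eq_iff funpow_inv_left[OF assms] funpow_inv_right[OF assms])

lemma iter_tau:
  assumes "tds T" "i \<in> {1..d}"
  shows "iter (tau T d) n p i = iter T (int i * n) (p i)"
proof (cases "n \<ge> 0")
  case True
  then show ?thesis using assms(2) by (simp add: iter_def funpow_tau nat_mult_distrib)
next
  case False
  then have "\<not> int i * n \<ge> 0" using assms(2) by (simp add: zero_le_mult_iff)
  moreover have "nat (- (int i * n)) = i * nat (- n)"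
    using False by (metis mult_minus_right nat_int nat_mult_distrib of_nat_0_le_iff)
  ultimately show ?thesis using False assms(2)
    by (simp add: iter_def inv_tau[OF assms(1)] funpow_tau)
qed

text \<open>This turns a negative time preceded by a long enough forward return into an ordinary
  power.\<close>

lemma iter_funpow:
  assumes "tds T" "g + int m \<ge> 0"
  shows "iter T g ((T ^^ m) x) = (T ^^ nat (g + int m)) x"
proof (cases "g \<ge> 0")
  case True
  then show ?thesis by (simp add: iter_def nat_add_distrib funpow_add)
next
  case False
  then have "m = nat (- g) + nat (g + int m)" using assms(2) by simp
  then have "(T ^^ m) x = (T ^^ nat (- g)) ((T ^^ nat (g + int m)) x)"
    by (subst funpow_add[symmetric, THEN fun_cong, unfolded comp_apply]) simp
  then show ?thesis using False by (simp add: iter_def funpow_inv_left[OF assms(1)])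
qed

lemma saturated_diagonal_orbit_closure_iter:
  fixes T :: "'a::metric_space \<Rightarrow> 'a"
  assumes T: "tds T" and sat: "saturated \<pi> d (diagonal_orbit_closure T d x)"
    and U: "\<And>i. i \<in> {1..d} \<Longrightarrow> open (U i) \<and> U i \<inter> \<pi> -` {\<pi> x} \<noteq> {}"
  shows "\<exists>n. \<forall>i\<in>{1..d}. iter T (int i * n) x \<in> U i"
proof -
  let ?p = "\<lambda>i\<in>{1..d}. x"
  let ?O = "range (\<lambda>n. iter (tau T d) n ?p)"
  have "?p = iter (tau T d) 0 ?p" by (simp add: iter_def)
  then have "?p \<in> ?O" by blast
  then have p: "?p \<in> diagonal_orbit_closure T d x"
    unfolding diagonal_orbit_closure_def
    by (intro subsetD[OF closure_of_subset_Int]) (simp add: PiE_UNIV_domain)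
  have "\<forall>i\<in>{1..d}. \<exists>a. a \<in> U i \<and> \<pi> a = \<pi> x" using U by blast
  then obtain a where a: "\<And>i. i \<in> {1..d} \<Longrightarrow> a i \<in> U i \<and> \<pi> (a i) = \<pi> x"
    by metis
  \<comment> \<open>Coordinatewise this point has the same image as the diagonal point, so
    saturation applies; the box is a neighbourhood of it and must meet the orbit.\<close>
  have "(\<lambda>i\<in>{1..d}. a i) \<in> diagonal_orbit_closure T d x"
    using sat[unfolded saturated_def, rule_format, OF p] a by auto
  moreover have "(\<lambda>i\<in>{1..d}. a i) \<in> PiE {1..d} U" using a by auto
  moreover have "openin (power_topology d) (PiE {1..d} U)" using U by (simp add: openin_PiE)
  ultimately obtain n where "iter (tau T d) n ?p \<in> PiE {1..d} U"
    unfolding diagonal_orbit_closure_def in_closure_of by blast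
  then have "iter (tau T d) n ?p i \<in> U i" if "i \<in> {1..d}" for i
    using that by (rule PiE_mem)
  then show ?thesis by (intro exI[of _ n]) (simp add: iter_tau[OF T])
qed

text \<open>A possibly negative time is made positive by first following a long return of \<open>x\<close> to itself.\<close>

lemma near_returns_positive_time:
  fixes T :: "'a::metric_space \<Rightarrow> 'a"
  assumes T: "tds T" and x: "\<And>k. x \<in> near_returns T d k"
    and U: "\<And>i. i \<in> {1..d} \<Longrightarrow> open (U i)" "\<And>i. i \<in> {1..d} \<Longrightarrow> iter T (int i * n) x \<in> U i"
  shows "\<exists>m\<ge>1. \<forall>i\<in>{1..d}. (T ^^ (i * m)) x \<in> U i"
proof -
  have "open (\<Inter>i\<in>{1..d}. iter T (int i * n) -` U i)"
    using U(1) continuous_on_iter[OF T] by (intro open_INT) (auto simp: open_vimage)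
  moreover have "x \<in> (\<Inter>i\<in>{1..d}. iter T (int i * n) -` U i)" using U(2) by auto
  ultimately obtain e where e: "e > 0" "ball x e \<subseteq> (\<Inter>i\<in>{1..d}. iter T (int i * n) -` U i)"
    using openE by blast
  obtain k0 :: nat where k0: "1 / Suc k0 < e" using e(1) nat_approx_posE by blast
  \<comment> \<open>The term \<open>k0\<close> makes the error smaller than \<open>e\<close>; the
    rest makes \<open>n + m\<close> at least 1 for every \<open>m\<close> at least
    \<open>k\<close>.\<close>
  define k where "k = k0 + nat \<bar>n\<bar> + 1"
  have "1 / Suc k \<le> 1 / Suc k0" unfolding k_def by (simp add: frac_le)
  obtain m where m: "m \<ge> k" "\<And>j. j \<le> d \<Longrightarrow> dist ((T ^^ (j * m)) x) x < 1 / Suc k"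
    using x[of k] unfolding near_returns_def by blast
  have pos: "n + int m \<ge> 1" using m(1) unfolding k_def by linarith
  have "(T ^^ (i * nat (n + int m))) x \<in> U i" if i: "i \<in> {1..d}" for i
  proof -
    have "(T ^^ (i * m)) x \<in> ball x e"
      using m(2)[of i] i k0 \<open>1 / Suc k \<le> 1 / Suc k0\<close> by (simp add: dist_commute)
    then have "iter T (int i * n) ((T ^^ (i * m)) x) \<in> U i" using e(2) i by blast
    moreover have eq: "int i * n + int (i * m) = int i * (n + int m)"
      by (simp add: distrib_left)
    then have "int i * n + int (i * m) \<ge> 0" using pos by simp
    ultimately have "(T ^^ nat (int i * n + int (i * m))) x \<in> U i"
      using iter_funpow[OF T] by metis
    then show ?thesis unfolding eq by (simp add: nat_mult_distrib)
  qed
  then show ?thesis using pos by (intro exI[of _ "nat (n + int m)"]) auto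
qed

theorem theorem8p8:
  fixes T :: "'a::metric_space \<Rightarrow> 'a"
    and S :: "'b::metric_space \<Rightarrow> 'b"
    and \<pi> :: "'a \<Rightarrow> 'b"
    and d :: nat
  assumes "minimal_tds T"
    and "minimal_tds S"
    and "nontrivial_factor_map T S \<pi>"
    and "d \<ge> 2"
    and "topological_characteristic_factor d T S \<pi>"
  shows "\<exists>\<Omega>. gdelta \<Omega> \<and> closure \<Omega> = UNIV \<and>
           (\<forall>x\<in>\<Omega>. Delta_transitive_set T d (\<pi> -` {\<pi> x}))"
proof -
  have T: "tds T" and S: "tds S" using assms(1,2) by (simp_all add: minimal_tds_def)
  have \<pi>: "factor_map T S \<pi>" using assms(5) by (simp add: topological_characteristic_factor_def)
  obtain X0 where X0: "gdelta X0" "closure X0 = UNIV"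
    and sat: "\<And>x. x \<in> X0 \<Longrightarrow> saturated \<pi> d (diagonal_orbit_closure T d x)"
    using assms(5) unfolding topological_characteristic_factor_def by blast
  obtain F :: "nat \<Rightarrow> 'a set" where F: "X0 = \<Inter>(range F)" "\<And>n. open (F n)"
    using X0(1) by (auto elim: gdelta.cases)
  have dF: "closure (F n) = UNIV" for n
    using closure_mono[of X0 "F n"] X0(2) F(1) by auto
  \<comment> \<open>A point in all \<open>V n\<close> lies in \<open>X0\<close> and belongs to every
    \<open>near_returns T d n\<close>.\<close>
  define V where "V n = F n \<inter> near_returns T d n" for n
  have oV: "open (V n)" for n unfolding V_def using F(2) open_near_returns[OF T] by blast
  have dV: "closure (V n) = UNIV" for n
    using dF[of n] F(2)[of n] dense_near_returns[OF assms(1), of d n]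
    unfolding V_def closure_UNIV_iff by (metis Int_assoc open_Int)
  obtain \<Omega> where \<Omega>: "gdelta \<Omega>" "closure \<Omega> = UNIV"
    and fib: "\<And>x U. x \<in> \<Omega> \<Longrightarrow> open U \<Longrightarrow> U \<inter> \<pi> -` {\<pi> x} \<noteq> {} \<Longrightarrow>
       \<exists>z\<in>U \<inter> \<pi> -` {\<pi> x}. \<forall>n. z \<in> V n"
    using factor_map_generic_fibre_dense[where V = V, OF assms(1) S \<pi> oV dV] by metis
  have "Delta_transitive_set T d (\<pi> -` {\<pi> x})" if x: "x \<in> \<Omega>" for x
    unfolding Delta_transitive_set_def
  proof (intro conjI allI impI)
    let ?A = "\<pi> -` {\<pi> x}"
    show "closed ?A" using \<pi> by (simp add: factor_map_def closed_vimage)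
    fix U assume U: "\<forall>i\<in>{0..d}. open (U i) \<and> U i \<inter> ?A \<noteq> {}"
    \<comment> \<open>The generic point \<open>z\<close> replaces \<open>x\<close> as base point;
      since \<open>\<pi> z = \<pi> x\<close>, the fibre is unchanged.\<close>
    then obtain z where z: "z \<in> U 0" "\<pi> z = \<pi> x" "\<And>n. z \<in> V n"
      using fib[OF x, of "U 0"] by auto
    have "z \<in> X0" using z(3) unfolding F(1) V_def by blast
    moreover have U': "open (U i) \<and> U i \<inter> \<pi> -` {\<pi> z} \<noteq> {}" if "i \<in> {1..d}" for i
      using U that z(2) by auto
    ultimately obtain n where n: "\<forall>i\<in>{1..d}. iter T (int i * n) z \<in> U i"
      using saturated_diagonal_orbit_closure_iter[OF T sat, of z U] by blast
    have ret: "z \<in> near_returns T d k" for k using z(3) unfolding V_def by blast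
    obtain m where m: "m \<ge> 1" "\<And>i. i \<in> {1..d} \<Longrightarrow> (T ^^ (i * m)) z \<in> U i"
      using near_returns_positive_time[where U = U, OF T ret] U' n by blast
    \<comment> \<open>The point \<open>z\<close> witnesses the return: index 0 has exponent 0 and
      uses that \<open>z\<close> lies in \<open>U 0\<close> and in the fibre.\<close>
    have "z \<in> (\<Inter>i\<in>{0..d}. (T ^^ (i * m)) -` (U(0 := U 0 \<inter> ?A)) i)"
      using z(1,2) m(2) by auto
    then show "return_times T d (U(0 := U 0 \<inter> ?A)) \<noteq> {}"
      using m(1) unfolding return_times_def by blast
  qed
  then show ?thesis using \<Omega> by blast
qed

end
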